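(* Let $q$ be a prime power and $m,n$ positive integers. Then $h_{\tau_3}(\mathbb{F}_q^{mn})\le\lfloor\log_q(n)\rfloor$.
   Context: Write vectors of $\mathbb{F}_q^{mn}$ as $(b_1,\dots,b_n)$ with blocks $b_i\in\mathbb{F}_q^m$ and let $\tau_3(b_1,\dots,b_n)=(b_n,b_1,\dots,b_{n-1})$. A subspace $U\subseteq\mathbb{F}_q^{mn}$ is a $\tau_3$-covering if $\bigcup_{k=0}^{n-1}\tau_3^k(U)=\mathbb{F}_q^{mn}$, and $h_{\tau_3}(\mathbb{F}_q^{mn})$ is the largest codimension of a $\tau_3$-covering subspace. *)

theory Defs
  imports Complex_Main "Jordan_Normal_Form.VS_Connect"
begin

text \<open>
  A vector of length \<open>m * n\<close> is read as the concatenation of \<open>n\<close> blocks of length \<open>m\<close>.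
  Blocks and entries are numbered from \<open>0\<close>: entry \<open>i\<close> is entry \<open>i mod m\<close> of block \<open>i div m\<close>.
\<close>

definition block :: "nat \<Rightarrow> 'a vec \<Rightarrow> nat \<Rightarrow> 'a vec" where
  "block m v j = vec m (\<lambda>r. v $ (j * m + r))"

text \<open>Block \<open>j\<close> of the result is block \<open>j - 1\<close> of the argument, cyclically;
  \<open>j + n - 1\<close> avoids truncated subtraction at \<open>j = 0\<close>.\<close>

definition tau3 :: "nat \<Rightarrow> nat \<Rightarrow> 'a vec \<Rightarrow> 'a vec" where
  "tau3 m n v = vec (m * n) (\<lambda>i. block m v ((i div m + n - 1) mod n) $ (i mod m))"

lemma block_index_less:
  fixes m n j r :: nat
  assumes "j < n" "r < m"
  shows "j * m + r < m * n"
proof -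
  have "j * m + r < (j + 1) * m"
    using assms(2) by simp
  also have "\<dots> \<le> n * m"
    using assms(1) by (intro mult_right_mono) auto
  finally show ?thesis
    by (simp add: mult.commute)
qed

lemma block_tau3:
  assumes "j < n"
  shows "block m (tau3 m n v) j = block m v (if j = 0 then n - 1 else j - 1)"
proof -
  have "(j + n - 1) mod n = (if j = 0 then n - 1 else j - 1)"
    using assms mod_add_self2[of "j - 1" n] by (cases j) auto
  then show ?thesis
    using assms by (intro eq_vecI) (auto simp: block_def tau3_def block_index_less)
qed

definition tau3_covering :: "nat \<Rightarrow> nat \<Rightarrow> 'a :: field vec set \<Rightarrow> bool" where
  "tau3_covering m n U \<longleftrightarrow>
     subspace class_ring U (module_vec TYPE('a) (m * n)) \<and>
     (\<Union>k<n. (tau3 m n ^^ k) ` U) = carrier_vec (m * n)"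

definition codim :: "nat \<Rightarrow> 'a :: field vec set \<Rightarrow> nat" where
  "codim N U =
     vectorspace.dim class_ring (module_vec TYPE('a) N) -
     vectorspace.dim class_ring ((module_vec TYPE('a) N)\<lparr>carrier := U\<rparr>)"

definition h_tau3 :: "'a :: field itself \<Rightarrow> nat \<Rightarrow> nat \<Rightarrow> nat" where
  "h_tau3 _ m n = Max {codim (m * n) U | U :: 'a vec set. tau3_covering m n U}"

lemma tau3_covering_carrier:
  assumes "n > 0"
  shows "tau3_covering m n (carrier_vec (m * n) :: 'a :: field vec set)"
proof -
  interpret vec_space "TYPE('a)" "m * n" .
  have closed: "(tau3 m n ^^ k) v \<in> carrier_vec (m * n)"
    if "v \<in> carrier_vec (m * n)" for k and v :: "'a vec"
    using that by (induction k) (auto simp: tau3_def)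
  have "subspace class_ring (carrier_vec (m * n)) V"
    by (simp add: subspace_def submodule_def vectorspace_axioms module_axioms)
  moreover have "(\<Union>k<n. (tau3 m n ^^ k) ` carrier_vec (m * n)) = (carrier_vec (m * n) :: 'a vec set)"
    using closed assms by (auto intro!: bexI[of _ 0])
  ultimately show ?thesis
    by (simp add: tau3_covering_def)
qed

text \<open>The maximum in \<^const>\<open>h_tau3\<close> is taken over a finite nonempty set.\<close>

lemma finite_tau3_codims:
  "finite {codim (m * n) U | U :: 'a :: field vec set. tau3_covering m n U}"
  by (rule finite_subset
        [of _ "{..vectorspace.dim class_ring (module_vec TYPE('a) (m * n))}"])
     (auto simp: codim_def)

lemma tau3_codims_nonempty:
  "n > 0 \<Longrightarrow> {codim (m * n) U | U :: 'a :: field vec set. tau3_covering m n U} \<noteq> {}"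
  using tau3_covering_carrier by blast

end

theory Submission
  imports Defs
begin

text \<open>The bound is a counting argument. A covering subspace \<open>U\<close> exhausts the
  whole space by \<open>n\<close> images of itself, and each image has at most \<open>card U\<close>
  elements. Over a field with q elements a space of dimension d has q^d elements
  (\<open>card_carrier_eq_power_dim\<close>), so q^(mn) is at most n * q^(dim U). Cancelling q^(dim
  U) gives q^(codim U) \<le> n (\<open>card_power_codim_le\<close>), and taking logarithms to base q
  finishes the proof.\<close>

lemma (in vectorspace) card_carrier_eq_power_dim:
  assumes "fin_dim"
  shows "card (carrier V) = card (carrier K) ^ dim"
proof -
  obtain B where B: "finite B" "basis B"
    using finite_basis_exists[OF assms] by blast
  then have "B \<subseteq> carrier V"
    by (simp add: basis_def)
  have unique: "\<exists>!a. a \<in> B \<rightarrow>\<^sub>E carrier K \<and> lincomb a B = v" if "v \<in> carrier V" for v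
    using basis_criterion[OF B(1) \<open>B \<subseteq> carrier V\<close>] B(2) that by simp
  \<comment> \<open>Coordinates with respect to \<open>B\<close>: extensional functions are used so
    that a vector determines its coefficient function uniquely, with no freedom outside
    \<open>B\<close>.\<close>
  have "bij_betw (\<lambda>a. lincomb a B) (B \<rightarrow>\<^sub>E carrier K) (carrier V)"
  proof (rule bij_betw_imageI)
    have closed: "lincomb a B \<in> carrier V" if "a \<in> B \<rightarrow>\<^sub>E carrier K" for a
      using that \<open>B \<subseteq> carrier V\<close> by (intro lincomb_closed) auto
    show "inj_on (\<lambda>a. lincomb a B) (B \<rightarrow>\<^sub>E carrier K)"
      using unique closed by (intro inj_onI) (metis (no_types, lifting))
    show "(\<lambda>a. lincomb a B) ` (B \<rightarrow>\<^sub>E carrier K) = carrier V"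
      using ex1_implies_ex[OF unique] closed by blast
  qed
  then have "card (carrier V) = card (B \<rightarrow>\<^sub>E carrier K)"
    by (simp add: bij_betw_same_card)
  also have "\<dots> = card (carrier K) ^ dim"
    using B by (simp add: card_PiE dim_basis)
  finally show ?thesis .
qed

lemma card_power_codim_le:
  fixes U :: "'a :: {field, finite} vec set"
  assumes "tau3_covering m n U" and "n > 0"
  shows "card (UNIV :: 'a set) ^ codim (m * n) U \<le> n"
proof -
  interpret vec_space "TYPE('a)" "m * n" .
  interpret U: vectorspace class_ring "V\<lparr>carrier := U\<rparr>"
    using assms(1) by (intro subspace_is_vs) (simp add: tau3_covering_def)
  have card_V: "card (carrier_vec (m * n) :: 'a vec set) = card (UNIV :: 'a set) ^ (m * n)"
    using card_carrier_eq_power_dim[OF fin_dim] by (simp add: dim_is_n class_ring_simps)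
  \<comment> \<open>An infinite set has \<open>card\<close> equal to 0, whereas a power of q is
    positive.\<close>
  then have "finite (carrier_vec (m * n) :: 'a vec set)"
    by (intro card_ge_0_finite) (simp add: finite_UNIV_card_ge_0)
  moreover have "U \<subseteq> carrier_vec (m * n)"
    using assms(1) by (auto simp: tau3_covering_def subspace_def submodule_def)
  ultimately have "finite U"
    by (rule finite_subset[rotated])
  \<comment> \<open>The finite set \<open>U\<close> serves as its own generating set.\<close>
  then have "U.fin_dim"
    using U.in_own_span[of U] U.span_is_subset2[of U]
    unfolding U.fin_dim_def by (intro exI[of _ U]) simp
  then have card_U: "card U = card (UNIV :: 'a set) ^ U.dim"
    using U.card_carrier_eq_power_dim by (simp add: class_ring_simps)
  have "card (UNIV :: 'a set) ^ (m * n) = card (\<Union>k<n. (tau3 m n ^^ k) ` U)"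
    using assms(1) card_V by (simp add: tau3_covering_def)
  also have "\<dots> \<le> (\<Sum>k<n. card ((tau3 m n ^^ k) ` U))"
    by (rule card_UN_le) simp
  also have "\<dots> \<le> (\<Sum>k<n. card U)"
    by (intro sum_mono card_image_le \<open>finite U\<close>)
  finally have bound: "card (UNIV :: 'a set) ^ (m * n) \<le> n * card (UNIV :: 'a set) ^ U.dim"
    by (simp add: card_U)
  show ?thesis
  \<comment> \<open>\<open>codim\<close> is a truncated difference of naturals. Splitting here
    avoids proving that a subspace has dimension at most \<open>m * n\<close>: otherwise the
    difference is 0 and the claim reads 1 \<le> n.\<close>
  proof (cases "U.dim \<le> m * n")
    case True
    then have "card (UNIV :: 'a set) ^ codim (m * n) U * card (UNIV :: 'a set) ^ U.dim = card (UNIV :: 'a set) ^ (m * n)"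
      by (simp add: codim_def dim_is_n flip: power_add)
    with bound show ?thesis
      by (metis finite_UNIV_card_ge_0 finite mult_le_cancel2 zero_less_power)
  next
    case False
    then show ?thesis
      using \<open>n > 0\<close> by (simp add: codim_def dim_is_n)
  qed
qed

theorem theorem4p2:
  fixes q m n :: nat
  assumes "card (UNIV :: 'a :: {field, finite} set) = q"
    and "m > 0" and "n > 0"
  shows "int (h_tau3 TYPE('a) m n) \<le> \<lfloor>log (real q) (real n)\<rfloor>"
proof -
  \<comment> \<open>0 and 1 are distinct in a field, so the base of the logarithm exceeds 1.\<close>
  have "card {0, 1 :: 'a} \<le> q"
    unfolding assms(1)[symmetric] by (rule card_mono) auto
  then have "q > 1"
    by simp
  \<comment> \<open>The maximum is attained, so the counting bound for a single covering subspace
    applies to it.\<close>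
  have "h_tau3 TYPE('a) m n \<in> {codim (m * n) U | U :: 'a vec set. tau3_covering m n U}"
    unfolding h_tau3_def
    using finite_tau3_codims tau3_codims_nonempty[OF \<open>n > 0\<close>] by (rule Max_in)
  then have "q ^ h_tau3 TYPE('a) m n \<le> n"
    using card_power_codim_le \<open>n > 0\<close> assms(1) by auto
  then have "real q ^ h_tau3 TYPE('a) m n \<le> real n"
    by (metis of_nat_le_iff of_nat_power)
  then show ?thesis
    using \<open>q > 1\<close> \<open>n > 0\<close> by (simp add: le_floor_iff le_log_iff powr_realpow)
qed

end
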